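(* Let $r$ be a positive integer and let $P$ be any $r$-differential poset with rank function $p_0,p_1,p_2,\dots$. Then there exists a constant $a$ such that $$p_n\gg n^a e^{2\sqrt{rn}}.$$
   Context: Let $r$ be a positive integer and let $P=\bigcup_{n\ge 0}P_n$ be a locally finite graded poset ($P_n$ is the set of elements of rank $n$) with a unique element of rank zero. $P$ is $r$-differential if: (i) two distinct elements $x,y\in P$ cover exactly $k$ common elements if and only if they are covered by exactly $k$ common elements; (ii) an element $x\in P$ covers exactly $m$ elements if and only if it is covered by exactly $m+r$ elements. Its rank function is $p_n=|P_n|$. For functions $f,g:\mathbb N\to\mathbb R^{+}$, $f(n)\gg g(n)$ means that there is a positive constant $C$ such that $f(n)\ge C g(n)$ for all sufficiently large $n$. The constant $a$ is a real number. *)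

theory Defs
  imports Complex_Main "HOL-Library.Landau_Symbols"
begin

text \<open>
  A poset is a carrier set \<open>P\<close> with a relation \<open>R\<close> such that \<open>partial_order_on P R\<close>;
  \<open>(x, y) \<in> R\<close> means \<open>x \<le> y\<close>.
\<close>

definition covers :: "'a rel \<Rightarrow> 'a \<Rightarrow> 'a \<Rightarrow> bool" where
  "covers R y x \<longleftrightarrow>
     (x, y) \<in> R \<and> x \<noteq> y \<and> (\<forall>z. (x, z) \<in> R \<and> (z, y) \<in> R \<longrightarrow> z = x \<or> z = y)"

definition locally_finite_poset :: "'a set \<Rightarrow> 'a rel \<Rightarrow> bool" where
  "locally_finite_poset P R \<longleftrightarrow>
     partial_order_on P R \<and> (\<forall>x\<in>P. \<forall>y\<in>P. finite {z. (x, z) \<in> R \<and> (z, y) \<in> R})"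

text \<open>
  On a locally finite poset the following rank function axioms amount to every maximal chain
  meeting the ranks 0, 1, 2, ... in turn, without gaps.
\<close>

definition rank_function :: "'a set \<Rightarrow> 'a rel \<Rightarrow> ('a \<Rightarrow> nat) \<Rightarrow> bool" where
  "rank_function P R \<rho> \<longleftrightarrow>
     (\<forall>x\<in>P. (\<forall>y. (y, x) \<in> R \<longrightarrow> y = x) \<longrightarrow> \<rho> x = 0) \<and>
     (\<forall>x\<in>P. \<forall>y\<in>P. covers R y x \<longrightarrow> \<rho> y = Suc (\<rho> x))"

definition rank_level :: "'a set \<Rightarrow> ('a \<Rightarrow> nat) \<Rightarrow> nat \<Rightarrow> 'a set" where
  "rank_level P \<rho> n = {x \<in> P. \<rho> x = n}"

text \<open>Needed because \<open>card\<close> is 0 on infinite sets.\<close>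

definition has_exactly :: "'a set \<Rightarrow> nat \<Rightarrow> bool" where
  "has_exactly A k \<longleftrightarrow> finite A \<and> card A = k"

definition differential_poset :: "nat \<Rightarrow> 'a set \<Rightarrow> 'a rel \<Rightarrow> ('a \<Rightarrow> nat) \<Rightarrow> bool" where
  "differential_poset r P R \<rho> \<longleftrightarrow>
     r > 0 \<and> locally_finite_poset P R \<and> rank_function P R \<rho> \<and>
     (\<exists>!x. x \<in> rank_level P \<rho> 0) \<and>
     (\<forall>x\<in>P. \<forall>y\<in>P. x \<noteq> y \<longrightarrow>
        (\<forall>k. has_exactly {z. covers R x z \<and> covers R y z} k \<longleftrightarrow>
             has_exactly {z. covers R z x \<and> covers R z y} k)) \<and>
     (\<forall>x\<in>P. \<forall>m. has_exactly {z. covers R x z} m \<longleftrightarrow> has_exactly {z. covers R z x} (m + r))"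

text \<open>
  The rank function of the poset in the enumerative sense, \<open>p\<^sub>n = |P\<^sub>n|\<close>. All levels of a
  differential poset are finite (by induction on \<open>n\<close>, from the last condition above), so
  \<open>card\<close> is harmless here.
\<close>

definition rank_size :: "'a set \<Rightarrow> ('a \<Rightarrow> nat) \<Rightarrow> nat \<Rightarrow> nat" where
  "rank_size P \<rho> n = card (rank_level P \<rho> n)"

end

theory Submission
  imports Defs "HOL-Analysis.Convex" "HOL-Real_Asymp.Real_Asymp"
begin

text \<open>
  Let \<open>e x\<close> be the number of saturated chains from the bottom element to \<open>x\<close>. Stanley's commutation
  relation \<open>DU - UD = r I\<close> yields that the values of \<open>e\<close> on the elements covering \<open>x \<in> P\<^sub>n\<close> sum to
  \<open>r (n + 1) e x\<close>. Hence the sum of \<open>e\<^sup>2\<close> over \<open>P\<^sub>n\<close> is \<open>r\<^sup>n n!\<close>, while the sums \<open>A\<^sub>n\<close> of \<open>e\<close> over \<open>P\<^sub>n\<close>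
  satisfy a three-term recurrence, so that \<open>A\<^sub>n / sqrt (r\<^sup>n n!)\<close> grows at least like
  \<open>exp (sqrt (r n)) / n\<close>. The Cauchy-Schwarz inequality gives \<open>p\<^sub>n \<ge> A\<^sub>n\<^sup>2 / (r\<^sup>n n!)\<close>.
\<close>

text \<open>Double counting of a relation; both inner ranges depend on the outer index, as for
  covers between levels.\<close>

lemma sum_swap_dependent:
  assumes "finite A" "finite B"
    and "\<And>x. x \<in> A \<Longrightarrow> finite (F x)" "\<And>y. y \<in> B \<Longrightarrow> finite (G y)"
    and "\<And>x y. x \<in> A \<and> y \<in> F x \<longleftrightarrow> y \<in> B \<and> x \<in> G y"
  shows "(\<Sum>x\<in>A. \<Sum>y\<in>F x. f x y) = (\<Sum>y\<in>B. \<Sum>x\<in>G y. f x y)"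
proof -
  have "(\<Sum>x\<in>A. \<Sum>y\<in>F x. f x y) = (\<Sum>(x, y)\<in>Sigma A F. f x y)"
    using assms by (subst sum.Sigma) auto
  also have "\<dots> = (\<Sum>(y, x)\<in>Sigma B G. f x y)"
    by (rule sum.reindex_bij_witness[of _ prod.swap prod.swap]) (use assms(5) in fastforce)+
  also have "\<dots> = (\<Sum>y\<in>B. \<Sum>x\<in>G y. f x y)"
    using assms by (subst sum.Sigma) auto
  finally show ?thesis .
qed

section \<open>Covers and finiteness of rank levels\<close>

locale differential =
  fixes r :: nat and P :: "'a set" and R :: "'a rel" and \<rho> :: "'a \<Rightarrow> nat"
  assumes differential: "differential_poset r P R \<rho>"
begin

abbreviation level :: "nat \<Rightarrow> 'a set" where
  "level \<equiv> rank_level P \<rho>"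

definition up :: "'a \<Rightarrow> 'a set" where
  "up x = {z. covers R z x}"

definition down :: "'a \<Rightarrow> 'a set" where
  "down x = {z. covers R x z}"

lemma r_pos: "r > 0"
  using differential by (simp add: differential_poset_def)

lemma in_up_iff_in_down: "z \<in> up x \<longleftrightarrow> x \<in> down z"
  by (simp add: up_def down_def)

lemma partial_order: "partial_order_on P R"
  using differential by (simp add: differential_poset_def locally_finite_poset_def)

lemma covers_carrier: "covers R y x \<Longrightarrow> x \<in> P \<and> y \<in> P"
  using partial_order_onD(4)[OF partial_order] by (auto simp: covers_def)

lemma rank_function: "rank_function P R \<rho>"
  using differential by (simp add: differential_poset_def)

lemma rank_covers: "covers R y x \<Longrightarrow> \<rho> y = Suc (\<rho> x)"
  using rank_function covers_carrier[of y x] unfolding rank_function_def by blast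

lemma up_level: "z \<in> up x \<Longrightarrow> x \<in> level n \<Longrightarrow> z \<in> level (Suc n)"
  using covers_carrier[of z x] rank_covers[of z x] by (simp add: up_def rank_level_def)

lemma down_level: "z \<in> down x \<Longrightarrow> x \<in> level (Suc n) \<Longrightarrow> z \<in> level n"
  using covers_carrier[of x z] rank_covers[of x z] by (simp add: down_def rank_level_def)

lemma in_down_iff: "z \<in> level (Suc n) \<Longrightarrow> w \<in> down z \<longleftrightarrow> w \<in> level n \<and> z \<in> up w"
  using down_level in_up_iff_in_down by blast

lemma in_up_iff: "x \<in> level n \<Longrightarrow> z \<in> up x \<longleftrightarrow> z \<in> level (Suc n) \<and> x \<in> down z"
  using up_level in_up_iff_in_down by blast

lemma down_level_0: "x \<in> level 0 \<Longrightarrow> down x = {}"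
  using rank_covers by (force simp: down_def rank_level_def)

text \<open>Minimal elements have rank 0, so some \<open>y\<close> lies strictly below
  \<open>x\<close>. Local finiteness then yields a maximal element among those from \<open>y\<close>
  up to but excluding \<open>x\<close>, and \<open>x\<close> covers it.\<close>

lemma down_nonempty:
  assumes "x \<in> level (Suc n)"
  shows "down x \<noteq> {}"
proof -
  have xP: "x \<in> P" and "\<rho> x \<noteq> 0"
    using assms by (auto simp: rank_level_def)
  have "(\<forall>y. (y, x) \<in> R \<longrightarrow> y = x) \<longrightarrow> \<rho> x = 0"
    using rank_function xP unfolding rank_function_def by (elim conjE) (rule bspec)
  with \<open>\<rho> x \<noteq> 0\<close> obtain y where y: "(y, x) \<in> R" "y \<noteq> x"
    by auto
  let ?I = "{z. (y, z) \<in> R \<and> (z, x) \<in> R \<and> z \<noteq> x}"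
  have "y \<in> P"
    using partial_order_onD(4)[OF partial_order] y by auto
  then have "finite {z. (y, z) \<in> R \<and> (z, x) \<in> R}"
    using differential xP by (simp add: differential_poset_def locally_finite_poset_def)
  then have "finite ?I"
    by (rule rev_finite_subset) auto
  moreover have "y \<in> ?I"
    using y \<open>y \<in> P\<close> partial_order_onD(1)[OF partial_order] by (auto simp: refl_on_def)
  \<comment> \<open>The strict order is reversed, so that a minimal element for this relation is
    \<open>R\<close>-maximal in \<open>?I\<close>.\<close>
  moreover have "wf ({(b, a). (a, b) \<in> R \<and> a \<noteq> b} \<inter> ?I \<times> ?I)"
  proof (rule finite_acyclic_wf)
    show "finite ({(b, a). (a, b) \<in> R \<and> a \<noteq> b} \<inter> ?I \<times> ?I)"
      using \<open>finite ?I\<close> by auto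
    \<comment> \<open>Antisymmetry keeps composites off the diagonal; with transitivity, acyclicity
      reduces to irreflexivity.\<close>
    have "trans {(b, a). (a, b) \<in> R \<and> a \<noteq> b}"
      using partial_order_onD(2,3)[OF partial_order] unfolding trans_def antisym_def by blast
    then have "acyclic {(b, a). (a, b) \<in> R \<and> a \<noteq> b}"
      by (simp add: acyclic_def)
    then show "acyclic ({(b, a). (a, b) \<in> R \<and> a \<noteq> b} \<inter> ?I \<times> ?I)"
      by (rule acyclic_subset) auto
  qed
  ultimately obtain m where m: "m \<in> ?I"
    and max: "\<And>z. (z, m) \<in> {(b, a). (a, b) \<in> R \<and> a \<noteq> b} \<inter> ?I \<times> ?I \<Longrightarrow> z \<notin> ?I"
    by (metis (no_types, lifting) wfE_min)
  have "covers R x m"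
    unfolding covers_def
  proof (intro conjI allI impI)
    fix z assume z: "(m, z) \<in> R \<and> (z, x) \<in> R"
    then have "(y, z) \<in> R"
      using m partial_order_onD(2)[OF partial_order] by (auto dest: transD)
    then show "z = m \<or> z = x"
      using z m max[of z] by auto
  qed (use m in auto)
  then show ?thesis
    by (auto simp: down_def)
qed

lemma level_0: "\<exists>x. level 0 = {x}"
proof -
  have "\<exists>!x. x \<in> level 0"
    using differential by (simp add: differential_poset_def)
  then show ?thesis
    by blast
qed

lemma up_finite_card:
  assumes "x \<in> P" "finite (down x)"
  shows "finite (up x)" "card (up x) = card (down x) + r"
proof -
  have "has_exactly (down x) (card (down x))"
    using assms by (simp add: has_exactly_def)
  then have "has_exactly (up x) (card (down x) + r)"
    using differential assms by (simp add: differential_poset_def up_def down_def)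
  then show "finite (up x)" "card (up x) = card (down x) + r"
    by (auto simp: has_exactly_def)
qed

text \<open>Both claims go through one induction: finite \<open>down\<close> sets on a level force
  finite \<open>up\<close> sets, and by \<open>down_nonempty\<close> these exhaust the next
  level.\<close>

lemma finite_level: "finite (level n)"
  and finite_down_level: "x \<in> level n \<Longrightarrow> finite (down x)"
proof -
  have "finite (level n) \<and> (\<forall>x\<in>level n. finite (down x))"
  proof (induction n)
    case 0
    show ?case
      using level_0 down_level_0 by fastforce
  next
    case (Suc n)
    have "finite (up x)" if "x \<in> level n" for x
      using that Suc up_finite_card(1)[of x] by (auto simp: rank_level_def)
    then have "finite (\<Union>x\<in>level n. up x)"
      using Suc by auto
    moreover have "level (Suc n) \<subseteq> (\<Union>x\<in>level n. up x)"
    proof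
      fix x assume x: "x \<in> level (Suc n)"
      then obtain z where "z \<in> down x"
        using down_nonempty by blast
      with x show "x \<in> (\<Union>x\<in>level n. up x)"
        using down_level in_up_iff_in_down by blast
    qed
    moreover have "finite (down x)" if "x \<in> level (Suc n)" for x
      using that Suc down_level by (meson finite_subset subsetI)
    ultimately show ?case
      using finite_subset by blast
  qed
  then show "finite (level n)" "x \<in> level n \<Longrightarrow> finite (down x)"
    by auto
qed

lemma finite_up_level: "x \<in> level n \<Longrightarrow> finite (up x)"
  and card_up_level: "x \<in> level n \<Longrightarrow> card (up x) = card (down x) + r"
  using up_finite_card[of x] finite_down_level[of x n] by (simp_all add: rank_level_def)

section \<open>The commutation relation\<close>

lemma card_common_covers:
  assumes x: "x \<in> level n" and y: "y \<in> level n" and "x \<noteq> y"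
  shows "card (up x \<inter> up y) = card (down x \<inter> down y)"
proof -
  have "has_exactly (down x \<inter> down y) (card (down x \<inter> down y))"
    using x finite_down_level by (simp add: has_exactly_def)
  moreover have "up x \<inter> up y = {z. covers R z x \<and> covers R z y}"
    "down x \<inter> down y = {z. covers R x z \<and> covers R y z}"
    by (auto simp: up_def down_def)
  ultimately have "has_exactly (up x \<inter> up y) (card (down x \<inter> down y))"
    using differential assms by (simp add: differential_poset_def rank_level_def)
  then show ?thesis
    by (simp add: has_exactly_def)
qed

text \<open>Regrouped by the endpoint \<open>w\<close>, both double sums become sums over
  \<open>level n\<close>, weighted by the numbers of common upper and common lower covers of
  \<open>x\<close> and \<open>w\<close>.\<close>

lemma up_down_commute:
  fixes f :: "'a \<Rightarrow> real"
  assumes x: "x \<in> level n"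
  shows "(\<Sum>z\<in>up x. \<Sum>w\<in>down z. f w) = (\<Sum>z\<in>down x. \<Sum>w\<in>up z. f w) + r * f x"
proof -
  have up_sum: "(\<Sum>z\<in>up x. \<Sum>w\<in>down z. f w) = (\<Sum>w\<in>level n. card (up x \<inter> up w) * f w)"
  proof -
    have "(\<Sum>z\<in>up x. \<Sum>w\<in>down z. f w) = (\<Sum>w\<in>level n. \<Sum>z\<in>up x \<inter> up w. f w)"
    proof (rule sum_swap_dependent)
      show "z \<in> up x \<and> w \<in> down z \<longleftrightarrow> w \<in> level n \<and> z \<in> up x \<inter> up w" for z w
        using up_level[OF _ x] in_down_iff by blast
    qed (use x in \<open>auto intro: finite_up_level finite_level finite_down_level up_level\<close>)
    then show ?thesis
      by simp
  qed
  have down_sum: "(\<Sum>z\<in>down x. \<Sum>w\<in>up z. f w) = (\<Sum>w\<in>level n. card (down x \<inter> down w) * f w)"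
  proof (cases n)
    case 0
    then show ?thesis
      using x by (simp add: down_level_0)
  next
    case (Suc m)
    have "(\<Sum>z\<in>down x. \<Sum>w\<in>up z. f w) = (\<Sum>w\<in>level n. \<Sum>z\<in>down x \<inter> down w. f w)"
    proof (rule sum_swap_dependent)
      show "z \<in> down x \<and> w \<in> up z \<longleftrightarrow> w \<in> level n \<and> z \<in> down x \<inter> down w" for z w
        using down_level[of _ x m] x in_up_iff[of _ m] Suc by blast
      show "finite (up z)" if "z \<in> down x" for z
        using that x down_level finite_up_level unfolding Suc by blast
    qed (use x in \<open>auto intro: finite_level finite_down_level\<close>)
    then show ?thesis
      by simp
  qed
  \<comment> \<open>The weights agree for \<open>w \<noteq> x\<close> by
    \<open>card_common_covers\<close> and differ by \<open>r\<close> at \<open>w = x\<close> by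
    \<open>card_up_level\<close>.\<close>
  have "(\<Sum>w\<in>level n. card (up x \<inter> up w) * f w)
      = (\<Sum>w\<in>level n. card (down x \<inter> down w) * f w + (if w = x then r * f x else 0))"
    using x card_up_level card_common_covers
    by (intro sum.cong) (auto simp: algebra_simps)
  then show ?thesis
    using x finite_level by (simp add: up_sum down_sum sum.distrib)
qed

section \<open>Sums of chain counts over a level\<close>

text \<open>Recursion needs the length as an explicit argument: descending cover chains of length
  \<open>n\<close> from \<open>x\<close> are counted, and these reach the bottom element exactly
  when \<open>x\<close> is in \<open>level n\<close>, where the value is \<open>e x\<close>.\<close>

primrec chains :: "nat \<Rightarrow> 'a \<Rightarrow> real" where
  "chains 0 x = 1"
| "chains (Suc n) x = (\<Sum>z\<in>down x. chains n z)"

text \<open>Commuting once moves the upward sum one level down, where the induction hypothesis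
  applies; the extra term raises the factor by \<open>r\<close>.\<close>

lemma sum_up_chains:
  "x \<in> level n \<Longrightarrow> (\<Sum>z\<in>up x. chains (Suc n) z) = r * (n + 1) * chains n x"
proof (induction n arbitrary: x)
  case 0
  then show ?case
    using up_down_commute[OF 0, of "\<lambda>_. 1"] by (simp add: down_level_0)
next
  case (Suc n)
  have "(\<Sum>z\<in>up x. chains (Suc (Suc n)) z) = (\<Sum>z\<in>up x. \<Sum>w\<in>down z. chains (Suc n) w)"
    by simp
  also have "\<dots> = (\<Sum>z\<in>down x. \<Sum>w\<in>up z. chains (Suc n) w) + r * chains (Suc n) x"
    by (rule up_down_commute[OF Suc.prems])
  also have "(\<Sum>z\<in>down x. \<Sum>w\<in>up z. chains (Suc n) w) = (\<Sum>z\<in>down x. r * (n + 1) * chains n z)"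
    using Suc.prems down_level by (intro sum.cong refl Suc.IH) blast
  also have "\<dots> = r * (n + 1) * chains (Suc n) x"
    by (simp only: chains.simps(2) sum_distrib_left)
  finally show ?case
    by (simp add: algebra_simps del: chains.simps)
qed

lemma sum_level_Suc:
  "(\<Sum>x\<in>level (Suc n). \<Sum>z\<in>down x. f x z) = (\<Sum>z\<in>level n. \<Sum>x\<in>up z. f x z)"
proof (rule sum_swap_dependent)
  show "x \<in> level (Suc n) \<and> z \<in> down x \<longleftrightarrow> z \<in> level n \<and> x \<in> up z" for x z
    using in_down_iff up_level by blast
qed (auto intro: finite_level finite_down_level finite_up_level)

text \<open>Unfolding one factor of each square and exchanging the two levels leaves upward sums, so
  \<open>sum_up_chains\<close> contributes \<open>r * (n + 1)\<close> per level.\<close>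

lemma sum_chains_sq: "(\<Sum>x\<in>level n. (chains n x)\<^sup>2) = real r ^ n * fact n"
proof (induction n)
  case 0
  then show ?case
    using level_0 by auto
next
  case (Suc n)
  have "(\<Sum>x\<in>level (Suc n). (chains (Suc n) x)\<^sup>2)
      = (\<Sum>x\<in>level (Suc n). \<Sum>z\<in>down x. chains (Suc n) x * chains n z)"
    by (simp only: power2_eq_square sum_distrib_left[symmetric] chains.simps(2)[symmetric])
  also have "\<dots> = (\<Sum>z\<in>level n. chains n z * (\<Sum>x\<in>up z. chains (Suc n) x))"
    by (simp only: sum_level_Suc sum_distrib_right[symmetric]) (simp only: mult.commute)
  also have "\<dots> = (\<Sum>z\<in>level n. r * (n + 1) * (chains n z)\<^sup>2)"
    by (intro sum.cong) (simp_all add: sum_up_chains power2_eq_square del: chains.simps)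
  also have "\<dots> = r * (n + 1) * (\<Sum>z\<in>level n. (chains n z)\<^sup>2)"
    by (rule sum_distrib_left[symmetric])
  finally show ?case
    by (simp add: Suc.IH algebra_simps del: chains.simps)
qed

text \<open>These are the \<open>A\<^sub>n\<close>; for \<open>r = 1\<close> they are the involution
  numbers 1, 1, 2, 4, 10.\<close>

definition total_chains :: "nat \<Rightarrow> real" where
  "total_chains n = (\<Sum>x\<in>level n. chains n x)"

lemma total_chains_0: "total_chains 0 = 1"
  using level_0 by (auto simp: total_chains_def)

lemma total_chains_Suc:
  "total_chains (Suc n) = (\<Sum>z\<in>level n. (card (down z) + r) * chains n z)"
  by (simp add: total_chains_def sum_level_Suc card_up_level)

lemma total_chains_1: "total_chains (Suc 0) = r"
  using level_0 down_level_0 by (auto simp: total_chains_Suc)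

text \<open>In \<open>total_chains_Suc\<close> the summand \<open>r\<close> gives the first term.
  The summand \<open>card (down z)\<close> counts \<open>z\<close> once per lower cover; exchanging
  levels turns this into upward sums.\<close>

lemma total_chains_rec:
  "total_chains (Suc (Suc n)) = r * total_chains (Suc n) + r * (n + 1) * total_chains n"
proof -
  have "(\<Sum>z\<in>level (Suc n). card (down z) * chains (Suc n) z)
      = (\<Sum>z\<in>level (Suc n). \<Sum>w\<in>down z. chains (Suc n) z)"
    by (simp del: chains.simps)
  also have "\<dots> = (\<Sum>w\<in>level n. r * (n + 1) * chains n w)"
    unfolding sum_level_Suc by (intro sum.cong refl sum_up_chains)
  also have "\<dots> = r * (n + 1) * total_chains n"
    by (simp add: total_chains_def sum_distrib_left)
  finally show ?thesis
    by (simp add: total_chains_Suc[of "Suc n"] distrib_right sum.distrib del: chains.simps)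
      (simp add: total_chains_def sum_distrib_left del: chains.simps)
qed

lemma total_chains_pos: "total_chains n > 0"
proof (induction n rule: induct_nat_012)
  case (ge2 n)
  then show ?case
    unfolding total_chains_rec using r_pos
    by (intro add_pos_pos mult_pos_pos) (auto simp del: of_nat_mult of_nat_add)
qed (use r_pos in \<open>simp_all add: total_chains_0 total_chains_1\<close>)

text \<open>Cauchy-Schwarz against the constant function 1.\<close>

lemma total_chains_sq_le: "(total_chains n)\<^sup>2 \<le> rank_size P \<rho> n * (real r ^ n * fact n)"
  using sum_squared_le_sum_of_squares[of "chains n" "level n"]
  by (simp add: total_chains_def sum_chains_sq rank_size_def mult.commute)

section \<open>Normalization and growth of the recurrence\<close>

lemma normalized_total_chains_rec:
  fixes c :: "nat \<Rightarrow> real"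
  defines "c \<equiv> \<lambda>n. total_chains n / sqrt (real r ^ n * fact n)"
  shows "c (Suc (Suc n)) =
    sqrt r / sqrt (real n + 2) * c (Suc n) + sqrt ((real n + 1) / (real n + 2)) * c n"
proof -
  \<comment> \<open>By \<open>sum_chains_sq\<close>, \<open>q\<close> is the Euclidean norm of
    \<open>chains n\<close> on \<open>level n\<close>. Naming all the roots reduces the cancellation
    to a rational identity.\<close>
  define q where "q = sqrt (real r ^ n * fact n)"
  have q: "q > 0"
    using r_pos by (simp add: q_def)
  define t where "t = sqrt (real r)"
  define u where "u = sqrt (real n + 1)"
  define v where "v = sqrt (real n + 2)"
  have pos: "t > 0" "u > 0" "v > 0"
    using r_pos by (simp_all add: t_def u_def v_def)
  have sq: "real r = t * t" "real (n + 1) = u * u"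
    by (simp_all add: t_def u_def)
  have q1: "sqrt (real r ^ Suc n * fact (Suc n)) = t * u * q"
    by (simp add: q_def t_def u_def real_sqrt_mult mult_ac add_ac)
  have "real r ^ Suc (Suc n) * fact (Suc (Suc n))
      = real r * (real n + 2) * (real r ^ Suc n * fact (Suc n))"
    by (simp add: algebra_simps)
  then have q2: "sqrt (real r ^ Suc (Suc n) * fact (Suc (Suc n))) = t * v * (t * u * q)"
    unfolding q1[symmetric] by (simp only: real_sqrt_mult t_def v_def)
  have rec: "total_chains (Suc (Suc n))
      = t * t * total_chains (Suc n) + t * t * (u * u) * total_chains n"
    unfolding total_chains_rec of_nat_mult sq ..
  have "(t * t * total_chains (Suc n) + t * t * (u * u) * total_chains n) / (t * v * (t * u * q))
      = t / v * (total_chains (Suc n) / (t * u * q)) + u / v * (total_chains n / q)"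
    using q pos by (simp add: field_simps)
  then show ?thesis
    unfolding c_def q1 q2 rec q_def[symmetric] real_sqrt_divide
    by (simp add: t_def u_def v_def)
qed

end

text \<open>
  The denominator \<open>n\<close> makes \<open>exp (s * sqrt n) / n\<close> a subsolution: actual solutions grow like
  \<open>exp (s * sqrt n) / n powr (1/4)\<close>.
\<close>

lemma asymptotic_subsolution:
  fixes s :: real
  assumes "s > 0"
  shows "eventually (\<lambda>n::nat. exp (s * sqrt (real n + 2)) / (real n + 2) \<le>
      s / sqrt (real n + 2) * (exp (s * sqrt (real n + 1)) / (real n + 1))
      + sqrt ((real n + 1) / (real n + 2)) * (exp (s * sqrt n) / n)) at_top"
  using assms by real_asymp

text \<open>Comparison principle: the coefficients are nonnegative, so a multiple of a subsolution
  lying below \<open>c\<close> at two consecutive indices stays below it.\<close>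

lemma recurrence_lower_bound:
  fixes c :: "nat \<Rightarrow> real"
  assumes "s > 0" and pos: "\<And>n. c n > 0"
    and rec: "\<And>n. c (Suc (Suc n)) =
      s / sqrt (real n + 2) * c (Suc n) + sqrt ((real n + 1) / (real n + 2)) * c n"
  shows "\<exists>K>0. eventually (\<lambda>n. c n \<ge> K * (exp (s * sqrt n) / n)) at_top"
proof -
  define g where "g n = exp (s * sqrt n) / n" for n :: nat
  obtain N where N: "\<And>n. n \<ge> N \<Longrightarrow> g (Suc (Suc n)) \<le>
      s / sqrt (real n + 2) * g (Suc n) + sqrt ((real n + 1) / (real n + 2)) * g n"
    using asymptotic_subsolution[OF \<open>s > 0\<close>]
    by (auto simp: eventually_at_top_linorder g_def add_ac)
  \<comment> \<open>The successor ensures \<open>M > 0\<close>; at index 0 the division by zero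
    would make \<open>g\<close> vanish.\<close>
  define M where "M = Suc N"
  \<comment> \<open>The largest factor with \<open>K * g\<close> below \<open>c\<close> at both
    starting indices.\<close>
  define K where "K = min (c M / g M) (c (Suc M) / g (Suc M))"
  have g_pos: "g M > 0" "g (Suc M) > 0"
    by (simp_all add: g_def M_def)
  then have "K > 0"
    by (simp add: K_def pos)
  have "c n \<ge> K * g n \<and> c (Suc n) \<ge> K * g (Suc n)" if "n \<ge> M" for n
    using that
  proof (induction n rule: dec_induct)
    case base
    have "K \<le> c M / g M" "K \<le> c (Suc M) / g (Suc M)"
      by (simp_all add: K_def)
    with g_pos show ?case
      by (simp add: pos_le_divide_eq)
  next
    case (step n)
    have "K * g (Suc (Suc n))
        \<le> K * (s / sqrt (real n + 2) * g (Suc n) + sqrt ((real n + 1) / (real n + 2)) * g n)"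
      using step.hyps \<open>K > 0\<close> by (intro mult_left_mono N) (auto simp: M_def)
    also have "\<dots> = s / sqrt (real n + 2) * (K * g (Suc n))
        + sqrt ((real n + 1) / (real n + 2)) * (K * g n)"
      by (simp add: algebra_simps)
    also have "\<dots> \<le> c (Suc (Suc n))"
      unfolding rec using step.IH \<open>s > 0\<close> by (intro add_mono mult_left_mono) auto
    finally show ?case
      using step.IH by simp
  qed
  with \<open>K > 0\<close> show ?thesis
    by (auto simp: eventually_at_top_linorder g_def)
qed

theorem theorem13:
  fixes r :: nat and P :: "'a set" and R :: "'a rel" and \<rho> :: "'a \<Rightarrow> nat"
  assumes "r > 0" and "differential_poset r P R \<rho>"
  shows "\<exists>a::real. (\<lambda>n. real (rank_size P \<rho> n)) \<in>
           \<Omega>(\<lambda>n. real n powr a * exp (2 * sqrt (real r * real n)))"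
proof -
  interpret differential r P R \<rho>
    by unfold_locales (rule assms)
  define c where "c n = total_chains n / sqrt (real r ^ n * fact n)" for n
  have c_pos: "c n > 0" for n
    using r_pos total_chains_pos by (simp add: c_def)
  obtain K where "K > 0" and K: "eventually (\<lambda>n. c n \<ge> K * (exp (sqrt r * sqrt n) / n)) at_top"
    using recurrence_lower_bound[of "sqrt r" c] c_pos r_pos normalized_total_chains_rec
    unfolding c_def by auto
  have c_sq_le: "(c n)\<^sup>2 \<le> rank_size P \<rho> n" for n
    using total_chains_sq_le[of n] r_pos by (simp add: c_def power_divide field_simps)
  \<comment> \<open>The exponent -2 arises from squaring the factor \<open>1 / n\<close> in the
    lower bound for \<open>c\<close>.\<close>
  have "(\<lambda>n. real (rank_size P \<rho> n)) \<in>
      \<Omega>(\<lambda>n. real n powr (-2) * exp (2 * sqrt (real r * real n)))"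
  proof (rule landau_omega.bigI)
    show "K\<^sup>2 > 0"
      using \<open>K > 0\<close> by simp
    show "eventually (\<lambda>n. norm (real (rank_size P \<rho> n)) \<ge>
        K\<^sup>2 * norm (real n powr (-2) * exp (2 * sqrt (real r * real n)))) at_top"
      using K eventually_gt_at_top[of 0]
    proof eventually_elim
      case (elim n)
      have "exp (2 * sqrt (real r * real n)) = (exp (sqrt r * sqrt n))\<^sup>2"
        by (simp add: real_sqrt_mult exp_double)
      then have "K\<^sup>2 * (real n powr (-2) * exp (2 * sqrt (real r * real n)))
          = (K * (exp (sqrt r * sqrt n) / n))\<^sup>2"
        using elim by (simp add: powr_minus power_mult_distrib power_divide field_simps)
      also have "\<dots> \<le> (c n)\<^sup>2"
        using elim \<open>K > 0\<close> by (intro power_mono) auto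
      finally show ?case
        using c_sq_le[of n] by simp
    qed
  qed
  then show ?thesis ..
qed

end
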